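(* Let $l$, $n$ and $d\ge n$ be natural numbers and put $$\Psi(n,d,l)=2^{27}\, l\,(nd)^{3\log_3(nd)+9\log_3\log_3(nd)+36}.$$ Then every word over a linearly ordered $l$-letter alphabet of length at least $\Psi(n,d,l)$ either contains a subword of the form $x^d$ for some nonempty word $x$, or is $n$-divisible.
   Context: Lexicographic order on words: $u\succ v$ if there are (possibly empty) words $w,u',v'$ and letters $a\succ b$ with $u=wau'$, $v=wbv'$ (a word and its prefix are incomparable). A word $W$ is $n$-divisible if $W=v\,u_1u_2\cdots u_n$ with $u_1\succ u_2\succ\cdots\succ u_n$. A subword means a factor (a contiguous block of letters). Logarithms are to base $3$. *)

theory Defs
  imports Complex_Main "HOL-Library.Sublist"
begin

text \<open>
  Unlike in the library orders \<^const>\<open>lexord\<close> and \<^const>\<open>lexordp\<close>, a word and its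
  prefix are incomparable here.
\<close>

definition word_greater :: "'a::linorder list \<Rightarrow> 'a list \<Rightarrow> bool"  (infix "\<succ>" 50) where
  "u \<succ> v \<longleftrightarrow> (\<exists>w u' v' a b. u = w @ [a] @ u' \<and> v = w @ [b] @ v' \<and> a > b)"

definition n_divisible :: "nat \<Rightarrow> 'a::linorder list \<Rightarrow> bool" where
  "n_divisible n W \<longleftrightarrow> (\<exists>v us. length us = n \<and> W = v @ concat us \<and> successively (\<succ>) us)"

definition word_power :: "'a list \<Rightarrow> nat \<Rightarrow> 'a list" where
  "word_power x d = concat (replicate d x)"

text \<open>
  For \<open>n = d = 1\<close> the iterated logarithm is the junk value \<^term>\<open>log 3 0 :: real\<close>, which
  is harmless because the base of the power is then \<open>1\<close>.
\<close>

definition Psi :: "nat \<Rightarrow> nat \<Rightarrow> nat \<Rightarrow> real" where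
  "Psi n d l = 2 ^ 27 * real l *
     real (n * d) powr (3 * log 3 (real (n * d)) + 9 * log 3 (log 3 (real (n * d))) + 36)"

end

theory Submission
  imports Defs
begin

text \<open>
  Cut a word without \<open>n\<close>-division into blocks of equal length \<open>q\<close>. The sequence of blocks has no
  lexicographically decreasing subsequence of length \<open>n\<close>, so it splits into fewer than \<open>n\<close> weakly
  increasing sequences. If there are \<open>V\<close> different blocks, these sequences change value fewer than
  \<open>n V\<close> times in total, so a fraction \<open>1 / (n V)\<close> of the word is a run containing fewer than \<open>n\<close>
  different blocks. Glueing the blocks of this run in threes gives at most \<open>n\<^sup>3\<close> different blocks
  of length \<open>3 q\<close>, and the argument repeats. After \<open>log\<^sub>3 (n d)\<close> rounds the blocks have length at
  least \<open>n d\<close>, and some block occurs \<open>n\<close> times. Its first \<open>n\<close> suffixes are pairwise comparable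
  unless it contains a \<open>d\<close>-th power; choosing the \<open>k\<close>-th largest suffix in the \<open>k\<close>-th occurrence
  gives an \<open>n\<close>-division.
\<close>

subsection \<open>The lexicographic order\<close>

lemma word_greater_Nil [simp]: "\<not> [] \<succ> v" "\<not> u \<succ> []"
  by (auto simp: word_greater_def)

lemma word_greater_Cons [simp]: "x # u \<succ> y # v \<longleftrightarrow> x > y \<or> x = y \<and> u \<succ> v"
proof
  assume "x # u \<succ> y # v"
  then obtain w u' v' a b where
    *: "x # u = w @ [a] @ u'" "y # v = w @ [b] @ v'" "a > b"
    by (auto simp: word_greater_def)
  show "x > y \<or> x = y \<and> u \<succ> v"
  proof (cases w)
    case Nil
    with * show ?thesis by auto
  next
    case (Cons c w')
    with * have "x = y" "u = w' @ [a] @ u'" "v = w' @ [b] @ v'" by auto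
    with \<open>a > b\<close> show ?thesis unfolding word_greater_def by blast
  qed
next
  assume "x > y \<or> x = y \<and> u \<succ> v"
  then show "x # u \<succ> y # v"
  proof
    assume "x > y"
    then show ?thesis unfolding word_greater_def by (metis append_Cons append_Nil)
  next
    assume "x = y \<and> u \<succ> v"
    then show ?thesis unfolding word_greater_def by (metis append_Cons)
  qed
qed

lemma word_greater_trans: "u \<succ> v \<Longrightarrow> v \<succ> w \<Longrightarrow> u \<succ> w"
proof (induction u arbitrary: v w)
  case (Cons x u)
  then show ?case by (cases v; cases w) auto
qed simp

lemma word_greater_append: "u \<succ> v \<Longrightarrow> u @ s \<succ> v @ t"
  unfolding word_greater_def by (metis append_assoc)

lemma word_greater_or_prefix: "u \<succ> v \<or> v \<succ> u \<or> prefix u v \<or> prefix v u"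
proof (induction u arbitrary: v)
  case (Cons x u)
  then show ?case by (cases v) auto
qed simp

lemma word_greater_total:
  assumes "length u = length v" "u \<noteq> v"
  shows "u \<succ> v \<or> v \<succ> u"
  using word_greater_or_prefix[of u v] assms by (auto simp: prefix_def)

text \<open>Insertion sort for a relation that is total only on \<open>S\<close>. Lexicographic
  comparison is not total on all words, since a word and its prefix are incomparable.\<close>

lemma ex_sorted_wrt_list:
  assumes "finite S"
    and "\<And>x y z. R x y \<Longrightarrow> R y z \<Longrightarrow> R x z"
    and "\<And>x y. x \<in> S \<Longrightarrow> y \<in> S \<Longrightarrow> x \<noteq> y \<Longrightarrow> R x y \<or> R y x"
  shows "\<exists>xs. set xs = S \<and> length xs = card S \<and> sorted_wrt R xs"
  using assms(1,3)
proof (induction S rule: finite_induct)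
  case (insert x S)
  then obtain xs where xs: "set xs = S" "length xs = card S" "sorted_wrt R xs"
    by auto
  define ys where "ys = filter (\<lambda>y. R y x) xs @ x # filter (\<lambda>y. \<not> R y x) xs"
  have above: "R x y" if "y \<in> S" "\<not> R y x" for y
    using insert.prems[of x y] insert.hyps that by auto
  have "set ys = insert x S"
    using xs by (auto simp: ys_def)
  moreover have "length ys = card (insert x S)"
    using xs insert.hyps sum_length_filter_compl[of "\<lambda>y. R y x" xs] by (simp add: ys_def)
  moreover have "sorted_wrt R ys"
    unfolding ys_def sorted_wrt_append using xs above assms(2)
    by (auto intro: sorted_wrt_filter)
  ultimately show ?case by blast
qed simp

subsection \<open>Disjoint occurrences\<close>

text \<open>Gaps between the factors are allowed because skipping blocks and shortening factors both
  create them; \<open>disjoint_factors_split\<close> absorbs them again.\<close>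

fun disjoint_factors :: "'a list list \<Rightarrow> 'a list \<Rightarrow> bool" where
  "disjoint_factors [] W \<longleftrightarrow> True"
| "disjoint_factors (w # ws) W \<longleftrightarrow> (\<exists>v g. W = v @ w @ g \<and> disjoint_factors ws g)"

lemma disjoint_factors_append:
  "disjoint_factors ws W \<Longrightarrow> disjoint_factors ws (W @ c)"
proof (induction ws arbitrary: W)
  case (Cons w ws)
  then obtain v g where "W = v @ w @ g" "disjoint_factors ws g" by auto
  then have "W @ c = v @ w @ (g @ c)" "disjoint_factors ws (g @ c)"
    using Cons.IH by auto
  then show ?case by auto
qed simp

lemma disjoint_factors_prepend:
  assumes "disjoint_factors ws W"
  shows "disjoint_factors ws (a @ W)"
proof (cases ws)
  case (Cons w ws')
  with assms obtain v g where "W = v @ w @ g" "disjoint_factors ws' g" by auto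
  then have "a @ W = (a @ v) @ w @ g" by simp
  with Cons \<open>disjoint_factors ws' g\<close> show ?thesis unfolding Cons disjoint_factors.simps by blast
qed simp

lemma disjoint_factors_sublist:
  "disjoint_factors ws U \<Longrightarrow> sublist U W \<Longrightarrow> disjoint_factors ws W"
  by (auto simp: sublist_def disjoint_factors_append disjoint_factors_prepend)

text \<open>What is cut off in front of a factor joins the gap before it. This permits taking a
  different suffix from each copy of a repeated block.\<close>

lemma disjoint_factors_suffixes:
  "list_all2 suffix vs ws \<Longrightarrow> disjoint_factors ws W \<Longrightarrow> disjoint_factors vs W"
proof (induction vs ws arbitrary: W rule: list_all2_induct)
  case (Cons v vs w ws)
  then obtain a g where W: "W = a @ w @ g" and "disjoint_factors ws g" by auto
  with Cons have "disjoint_factors vs g" by blast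
  moreover obtain b where "w = b @ v" using \<open>suffix v w\<close> by (auto simp: suffix_def)
  then have "W = (a @ b) @ v @ g" using W by simp
  ultimately show ?case unfolding disjoint_factors.simps by blast
qed simp

lemma subseq_disjoint_factors: "subseq ws bs \<Longrightarrow> disjoint_factors ws (concat bs)"
proof (induction rule: list_emb.induct)
  case (list_emb_Cons xs ys y)
  then show ?case by (simp add: disjoint_factors_prepend)
next
  case (list_emb_Cons2 x y xs ys)
  then have "concat (y # ys) = [] @ x @ concat ys" by simp
  then show ?case using list_emb_Cons2 unfolding disjoint_factors.simps by blast
qed simp

text \<open>Each factor absorbs the gap after it. A comparison is decided at a letter inside both
  factors, so appended text does not affect it. The prefix clause strengthens the induction: it lets
  a new first factor be compared with the enlarged next one.\<close>

lemma disjoint_factors_split: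
  assumes "disjoint_factors ws W" "successively (\<succ>) ws" "ws \<noteq> []"
  shows "\<exists>v us. length us = length ws \<and> W = v @ concat us \<and> successively (\<succ>) us \<and>
           prefix (hd ws) (hd us)"
  using assms
proof (induction ws arbitrary: W)
  case (Cons w ws)
  then obtain v g where W: "W = v @ w @ g" and g: "disjoint_factors ws g" by auto
  show ?case
  proof (cases ws)
    case Nil
    show ?thesis
      by (rule exI[of _ v], rule exI[of _ "[w @ g]"]) (auto simp: W Nil)
  next
    case (Cons w' ws')
    then obtain v' us where us: "length us = length ws" "g = v' @ concat us"
      "successively (\<succ>) us" "prefix (hd ws) (hd us)"
      using Cons.IH[OF g] Cons.prems by auto
    then obtain u us' where us': "us = u # us'" using Cons by (cases us) auto
    with us Cons obtain t where "u = w' @ t" by (auto simp: prefix_def)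
    moreover have "w \<succ> w'" using Cons.prems Cons by auto
    ultimately have "w @ v' \<succ> u" by (simp add: word_greater_append)
    then show ?thesis
      by (intro exI[of _ v] exI[of _ "(w @ v') # us"]) (use W us us' in auto)
  qed
qed simp

lemma n_divisible_if_disjoint_factors:
  assumes "disjoint_factors ws W" "successively (\<succ>) ws" "ws \<noteq> []"
  shows "n_divisible (length ws) W"
  using disjoint_factors_split[OF assms] unfolding n_divisible_def by blast

subsection \<open>Repeated blocks\<close>

text \<open>The first hypothesis says that \<open>y\<close> has period \<open>length x\<close>.
  Putting another \<open>x\<close> in front of the power gives a prefix of \<open>x @ y\<close>;
  \<open>y\<close> is a prefix of it too, and the length bound decides which of the two is
  shorter.\<close>

lemma word_power_prefix:
  assumes "prefix y (x @ y)" "k * length x \<le> length y"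
  shows "prefix (word_power x k) y"
  using assms(2)
proof (induction k)
  case (Suc k)
  then have "prefix (word_power x k) y" by simp
  then have "prefix (word_power x (Suc k)) (x @ y)" by (simp add: word_power_def)
  moreover have "length (word_power x (Suc k)) \<le> length y"
    using Suc.prems by (simp add: word_power_def length_concat sum_list_replicate)
  ultimately show ?case using assms(1) prefix_length_prefix by blast
qed (simp add: word_power_def)

text \<open>Of two incomparable suffixes the shorter is a prefix of the longer, which therefore has
  period \<open>j - i\<close>; a block of length at least \<open>n * d\<close> has room for
  \<open>d\<close> such periods.\<close>

lemma comparable_suffixes:
  assumes len: "n * d \<le> length u" and "i < j" "j < n" "d \<ge> 1"
    and no_power: "\<not> (\<exists>x. x \<noteq> [] \<and> sublist (word_power x d) u)"
  shows "drop i u \<succ> drop j u \<or> drop j u \<succ> drop i u"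
proof (rule ccontr)
  assume "\<not> ?thesis"
  then have "prefix (drop i u) (drop j u) \<or> prefix (drop j u) (drop i u)"
    using word_greater_or_prefix by blast
  moreover have "n \<le> length u" using len \<open>d \<ge> 1\<close> by (metis le_trans mult.right_neutral mult_le_mono2)
  then have long: "j < length u" using \<open>j < n\<close> by simp
  then have "\<not> prefix (drop i u) (drop j u)"
    using \<open>i < j\<close> by (auto dest: prefix_length_le)
  ultimately have pre: "prefix (drop j u) (drop i u)" by blast
  define x where "x = take (j - i) (drop i u)"
  have split: "drop i u = x @ drop j u"
    using append_take_drop_id[of "j - i" "drop i u"] \<open>i < j\<close> by (simp add: x_def)
  have lx: "length x = j - i" using long \<open>i < j\<close> by (simp add: x_def)
  \<comment> \<open>The aim is \<open>d * (j - i) + i \<le> length u\<close>; replacing the summand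
    \<open>i\<close> by \<open>d * i\<close> reduces it to \<open>d * j \<le> n * d\<close>.\<close>
  have "i \<le> d * i" using \<open>d \<ge> 1\<close> by simp
  moreover have "d * (j - i) + d * i = d * j"
    using \<open>i < j\<close> by (simp flip: add_mult_distrib2)
  ultimately have "d * (j - i) + i \<le> d * j" by linarith
  also have "d * j + d \<le> n * d" using \<open>j < n\<close>
    by (metis Suc_leI mult.commute mult_Suc_right add.commute mult_le_mono1)
  finally have bound: "d * (j - i) + i + d \<le> length u" using len by simp
  have "prefix (drop i u) (x @ drop i u)"
    using pre split by simp
  then have "prefix (word_power x d) (drop i u)"
    by (rule word_power_prefix) (use bound lx in simp)
  then have "sublist (word_power x d) u"
    by (meson prefix_imp_sublist sublist_drop sublist_order.order_trans)
  moreover have "x \<noteq> []" using lx \<open>i < j\<close> by auto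
  ultimately show False using no_power by blast
qed

text \<open>The suffixes \<open>drop i u\<close> with \<open>i < n\<close> are distinct by length
  and pairwise comparable, so they can be listed in decreasing order and distributed over the copies
  of \<open>u\<close>.\<close>

lemma n_divisible_if_repeated_block:
  assumes "n * d \<le> length u" "d \<ge> 1" "n \<ge> 1"
    and no_power: "\<not> (\<exists>x. x \<noteq> [] \<and> sublist (word_power x d) u)"
    and rep: "disjoint_factors (replicate n u) W"
  shows "n_divisible n W"
proof -
  define S where "S = (\<lambda>i. drop i u) ` {..<n}"
  have comp: "drop i u \<succ> drop j u \<or> drop j u \<succ> drop i u" if "i < n" "j < n" "i \<noteq> j" for i j
    using comparable_suffixes[OF assms(1) _ _ assms(2) no_power] that by (metis linorder_neqE_nat)
  have "n \<le> length u" using assms by (metis le_trans mult.right_neutral mult_le_mono2)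
  then have "inj_on (\<lambda>i. drop i u) {..<n}"
    by (auto intro!: inj_onI dest: arg_cong[where f = length])
  then have "card S = n" by (simp add: S_def card_image)
  obtain ws where ws: "set ws = S" "length ws = n" "sorted_wrt (\<succ>) ws"
    using ex_sorted_wrt_list[of S "(\<succ>)"] word_greater_trans comp \<open>card S = n\<close>
    unfolding S_def by (smt (verit) finite_imageI finite_lessThan imageE lessThan_iff)
  have "list_all2 suffix ws (replicate n u)"
    unfolding list_all2_conv_all_nth
  proof (intro conjI allI impI)
    fix k assume "k < length ws"
    then have "ws ! k \<in> S" using ws by auto
    then show "suffix (ws ! k) (replicate n u ! k)"
      using \<open>k < length ws\<close> ws by (auto simp: S_def suffix_drop)
  qed (use ws in simp)
  then have "disjoint_factors ws W" using rep by (rule disjoint_factors_suffixes)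
  moreover have "successively (\<succ>) ws"
    using ws by (simp add: successively_if_sorted_wrt)
  moreover have "ws \<noteq> []" using ws \<open>n \<ge> 1\<close> by auto
  ultimately show ?thesis using n_divisible_if_disjoint_factors ws by blast
qed

subsection \<open>Runs with few values\<close>

text \<open>The rank of \<open>i\<close> is the largest number of elements that can precede
  \<open>xs ! i\<close> in a chain ending there. Prolonging such a chain by a later element raises
  the rank, so positions of equal rank are never related by \<open>R\<close> in their order.\<close>

lemma ex_decreasing_rank:
  assumes "n \<ge> 1"
    and no_chain: "\<not> (\<exists>ys. subseq ys xs \<and> length ys = n \<and> successively R ys)"
  shows "\<exists>r :: nat \<Rightarrow> nat. (\<forall>i < length xs. r i < n - 1) \<and>
           (\<forall>i j. i < j \<longrightarrow> j < length xs \<longrightarrow> R (xs ! i) (xs ! j) \<longrightarrow> r i < r j)"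
proof -
  \<comment> \<open>The length \<open>k\<close> does not count \<open>xs ! i\<close> itself, hence
    the bound \<open>n - 1\<close> on the ranks.\<close>
  define K where
    "K i = {k. \<exists>ys. length ys = k \<and> subseq ys (take i xs) \<and> successively R (ys @ [xs ! i])}" for i
  have subseq_snoc: "subseq (ys @ [xs ! i]) (take (Suc i) xs)"
    if "subseq ys (take i xs)" "i < length xs" for ys i
    using that by (simp add: take_Suc_conv_app_nth list_emb_append_mono)
  have bound: "k < n - 1" if k: "k \<in> K i" "i < length xs" for k i
  proof (rule ccontr)
    assume "\<not> k < n - 1"
    obtain ys where ys: "length ys = k" "subseq ys (take i xs)" "successively R (ys @ [xs ! i])"
      using k by (auto simp: K_def)
    \<comment> \<open>The chain has at least \<open>n\<close> members, while \<open>no_chain\<close>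
      excludes exactly \<open>n\<close>; an initial piece of a chain is a chain.\<close>
    define zs where "zs = take n (ys @ [xs ! i])"
    have "length zs = n" using \<open>\<not> k < n - 1\<close> ys by (simp add: zs_def)
    moreover have "subseq zs xs"
      using subseq_snoc[OF ys(2) k(2)] unfolding zs_def
      by (meson prefix_imp_subseq subseq_order.order_trans take_is_prefix)
    moreover have "successively R zs"
      using ys(3) append_take_drop_id[of n "ys @ [xs ! i]"] unfolding zs_def
      by (metis successively_append_iff)
    ultimately show False using no_chain by blast
  qed
  have fin: "finite (K i)" if "i < length xs" for i
    using bound that by (meson bounded_nat_set_is_finite)
  have nonempty: "0 \<in> K i" for i by (simp add: K_def)
  have step: "Suc k \<in> K j"
    if k: "k \<in> K i" and "i < j" "j < length xs" "R (xs ! i) (xs ! j)" for i j k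
  proof -
    obtain ys where ys: "length ys = k" "subseq ys (take i xs)" "successively R (ys @ [xs ! i])"
      using k unfolding K_def by blast
    have "prefix (take (Suc i) xs) (take j xs)"
      using that(2) by (metis Suc_leI min.absorb1 take_is_prefix take_take)
    moreover have "subseq (ys @ [xs ! i]) (take (Suc i) xs)"
      using subseq_snoc ys that by auto
    ultimately have "subseq (ys @ [xs ! i]) (take j xs)"
      by (meson prefix_imp_subseq subseq_order.order_trans)
    moreover have "successively R ((ys @ [xs ! i]) @ [xs ! j])"
      using ys that(4) by (simp only: successively_append_iff) auto
    ultimately show ?thesis using ys(1) unfolding K_def by force
  qed
  have "Max (K i) < n - 1" if "i < length xs" for i
    using bound[OF Max_in] fin nonempty that by blast
  moreover have "Max (K i) < Max (K j)"
    if "i < j" "j < length xs" "R (xs ! i) (xs ! j)" for i j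
  proof -
    have "Max (K i) \<in> K i" 
      using Max_in[OF fin[of i]] nonempty[of i] that by (metis empty_iff order_less_trans)
    then have "Suc (Max (K i)) \<in> K j" using step that by blast
    then have "Suc (Max (K i)) \<le> Max (K j)" using Max_ge[OF fin[OF that(2)]] by blast
    then show ?thesis by simp
  qed
  ultimately show ?thesis by (intro exI[of _ "\<lambda>i. Max (K i)"]) simp
qed

lemma run_with_few_values:
  assumes "n \<ge> 1" "V \<ge> 1"
    and total: "\<And>x y. x \<in> set xs \<Longrightarrow> y \<in> set xs \<Longrightarrow> x \<noteq> y \<Longrightarrow> R x y \<or> R y x"
    and no_chain: "\<not> (\<exists>ys. subseq ys xs \<and> length ys = n \<and> successively R ys)"
    and card: "card (set xs) \<le> V" and len: "n * V * s \<le> length xs"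
  shows "\<exists>ys. sublist ys xs \<and> length ys = s \<and> card (set ys) < n"
proof -
  obtain r :: "nat \<Rightarrow> nat" where rank: "\<And>i. i < length xs \<Longrightarrow> r i < n - 1"
    and less: "\<And>i j. i < j \<Longrightarrow> j < length xs \<Longrightarrow> R (xs ! i) (xs ! j) \<Longrightarrow> r i < r j"
    using ex_decreasing_rank[OF \<open>n \<ge> 1\<close> no_chain] by blast
  define key where "key i = (r i, xs ! i)" for i
  \<comment> \<open>The indices where the weakly increasing sequence of rank \<open>r i\<close> takes a new value.\<close>
  define M where "M = {i. i < length xs \<and> (\<forall>j < i. key j \<noteq> key i)}"
  have "finite M" by (simp add: M_def)
  have "inj_on key M"
    unfolding M_def by (rule inj_onI) (metis (mono_tags, lifting) linorder_neqE_nat mem_Collect_eq)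
  moreover have "key ` M \<subseteq> {..<n - 1} \<times> set xs"
    using rank by (auto simp: M_def key_def)
  ultimately have "card M \<le> (n - 1) * card (set xs)"
    using card_inj_on_le[of key M "{..<n - 1} \<times> set xs"] by (simp add: card_cartesian_product)
  also have "\<dots> \<le> (n - 1) * V" using card by simp
  also have "\<dots> < n * V" using assms(1,2) by simp
  finally have "card M < n * V" .
  \<comment> \<open>Pigeonhole: among \<open>n * V\<close> disjoint windows of length
    \<open>s\<close>, one avoids the smaller set \<open>M\<close>.\<close>
  have "\<exists>k < n * V. M \<inter> {k * s..<k * s + s} = {}"
  proof (rule ccontr)
    assume "\<not> ?thesis"
    then have "\<forall>k. \<exists>i. k < n * V \<longrightarrow> i \<in> M \<and> k * s \<le> i \<and> i < k * s + s" by fastforce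
    then obtain h where h: "\<And>k. k < n * V \<Longrightarrow> h k \<in> M \<and> k * s \<le> h k \<and> h k < k * s + s"
      by metis
    have "h k div s = k" if "k < n * V" for k
      using h[OF that] by (intro div_nat_eqI) (auto simp: mult.commute)
    then have "inj_on h {..<n * V}" by (metis inj_onI lessThan_iff)
    moreover have "h ` {..<n * V} \<subseteq> M" using h by auto
    ultimately show False
      using card_inj_on_le[of h "{..<n * V}" M] \<open>finite M\<close> \<open>card M < n * V\<close> by simp
  qed
  then obtain k where k: "k < n * V" "M \<inter> {k * s..<k * s + s} = {}" by blast
  define a where "a = k * s"
  have "a + s \<le> length xs"
  proof -
    have "a + s = Suc k * s" by (simp add: a_def)
    also have "\<dots> \<le> n * V * s" using k by (intro mult_le_mono1) simp
    finally show ?thesis using len by simp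
  qed
  \<comment> \<open>Inside the window the value depends only on the rank, and there are at most
    \<open>n - 1\<close> ranks.\<close>
  have no_descent: "\<not> (i < j \<and> r i = r j \<and> xs ! i \<noteq> xs ! j)"
    if ij: "i \<in> {a..<a + s}" "j \<in> {a..<a + s}" for i j
  proof
    assume *: "i < j \<and> r i = r j \<and> xs ! i \<noteq> xs ! j"
    have "i < length xs" "j < length xs" using ij \<open>a + s \<le> length xs\<close> by auto
    then have "R (xs ! j) (xs ! i)"
      using total[of "xs ! i" "xs ! j"] less[of i j] * by auto
    \<comment> \<open>The first position with the rank and value of \<open>j\<close> lies in
      \<open>M\<close>, hence before the window and before \<open>i\<close>. Since its value is
      \<open>R\<close>-above \<open>xs ! i\<close>, its rank would be smaller than that of
      \<open>i\<close>, although the two ranks agree.\<close>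
    define j0 where "j0 = (LEAST j'. key j' = key j)"
    have j0: "key j0 = key j" "j0 \<le> j"
      unfolding j0_def by (auto intro: LeastI[of _ j] Least_le)
    have "key j' \<noteq> key j" if "j' < j0" for j'
      using not_less_Least[of j' "\<lambda>j'. key j' = key j"] that unfolding j0_def by simp
    then have "j0 \<in> M"
      using j0 \<open>j < length xs\<close> unfolding M_def by auto
    then have "j0 < a" using k(2) j0(2) ij by (fastforce simp: a_def)
    then have "r j0 < r i"
      using less[of j0 i] ij \<open>i < length xs\<close> \<open>R (xs ! j) (xs ! i)\<close> j0(1) by (auto simp: key_def)
    then show False using * j0(1) by (simp add: key_def)
  qed
  define ys where "ys = take s (drop a xs)"
  \<comment> \<open>By \<open>no_descent\<close> the choice of position does not matter. A rank
    absent from the window gets an arbitrary value, which does no harm to the upper bound on the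
    number of values.\<close>
  define g where "g c = xs ! (SOME i. i \<in> {a..<a + s} \<and> r i = c)" for c
  have "xs ! i = g (r i)" if "i \<in> {a..<a + s}" for i
  proof -
    define i' where "i' = (SOME i'. i' \<in> {a..<a + s} \<and> r i' = r i)"
    have "i' \<in> {a..<a + s} \<and> r i' = r i"
      unfolding i'_def by (rule someI[of _ i]) (use that in simp)
    then show ?thesis
      using no_descent[of i i'] no_descent[of i' i] that
      unfolding g_def i'_def[symmetric] by (metis linorder_neqE_nat)
  qed
  moreover have "ys = map ((!) xs) [a..<a + s]"
    using \<open>a + s \<le> length xs\<close> by (intro nth_equalityI) (auto simp: ys_def)
  then have "set ys = (!) xs ` {a..<a + s}" by simp
  ultimately have "set ys \<subseteq> g ` {..<n - 1}"
    using rank \<open>a + s \<le> length xs\<close> by fastforce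
  then have "card (set ys) \<le> n - 1"
    by (metis card_image_le card_lessThan card_mono finite_imageI finite_lessThan le_trans)
  moreover have "length ys = s" using \<open>a + s \<le> length xs\<close> by (simp add: ys_def)
  moreover have "sublist ys xs"
    unfolding ys_def by (meson sublist_drop sublist_order.order_trans sublist_take)
  ultimately show ?thesis using \<open>n \<ge> 1\<close> by (intro exI[of _ ys]) simp
qed

subsection \<open>Glueing blocks\<close>

text \<open>A remainder of one or two blocks is dropped, so that blocks of a common length yield
  blocks of a common length and distinct ones stay comparable.\<close>

fun glue_triples :: "'a list list \<Rightarrow> 'a list list" where
  "glue_triples (a # b # c # bs) = (a @ b @ c) # glue_triples bs"
| "glue_triples _ = []"

lemma length_glue_triples: "length (glue_triples bs) = length bs div 3"
  by (induction bs rule: glue_triples.induct) auto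

lemma prefix_concat_glue_triples: "prefix (concat (glue_triples bs)) (concat bs)"
  by (induction bs rule: glue_triples.induct) auto

lemma set_glue_triples:
  "set (glue_triples bs) \<subseteq> (\<lambda>(a, b, c). a @ b @ c) ` (set bs \<times> set bs \<times> set bs)"
  by (induction bs rule: glue_triples.induct) (auto simp: image_iff)

lemma card_glue_triples: "card (set (glue_triples bs)) \<le> card (set bs) ^ 3"
proof -
  have "card (set (glue_triples bs)) \<le> card (set bs \<times> set bs \<times> set bs)"
    using set_glue_triples by (rule surj_card_le[rotated]) simp
  then show ?thesis by (simp add: card_cartesian_product power3_eq_cube mult.assoc)
qed

lemma sublist_concat: "sublist ys xs \<Longrightarrow> sublist (concat ys) (concat xs)"
  unfolding sublist_def by (metis concat_append)

text \<open>Distinct blocks of equal length are comparable, and a decreasing subsequence of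
  \<open>n\<close> blocks would be an \<open>n\<close>-division of \<open>W\<close>.\<close>

lemma run_with_few_blocks:
  assumes "n \<ge> 1" "V \<ge> 1" and not_div: "\<not> n_divisible n W"
    and sub: "sublist (concat bs) W" and q: "\<And>b. b \<in> set bs \<Longrightarrow> length b = q"
    and "card (set bs) \<le> V" "n * V * s \<le> length bs"
  shows "\<exists>cs. sublist cs bs \<and> length cs = s \<and> card (set cs) < n"
proof (rule run_with_few_values[where R = "(\<succ>)"])
  show "\<not> (\<exists>ys. subseq ys bs \<and> length ys = n \<and> successively (\<succ>) ys)"
  proof
    assume "\<exists>ys. subseq ys bs \<and> length ys = n \<and> successively (\<succ>) ys"
    then obtain ys where ys: "subseq ys bs" "length ys = n" "successively (\<succ>) ys" by blast
    have "disjoint_factors ys W"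
      using disjoint_factors_sublist[OF subseq_disjoint_factors[OF ys(1)] sub] .
    moreover have "ys \<noteq> []" using ys \<open>n \<ge> 1\<close> by auto
    ultimately show False
      using n_divisible_if_disjoint_factors ys not_div by blast
  qed
qed (use assms word_greater_total in auto)

section \<open>Iterating the rounds\<close>

lemma replicate_subseq: "k \<le> count_list bs u \<Longrightarrow> subseq (replicate k u) bs"
proof (induction bs arbitrary: k)
  case (Cons b bs)
  show ?case
  proof (cases "b = u")
    case True
    with Cons show ?thesis by (cases k) auto
  next
    case False
    with Cons show ?thesis by (simp add: list_emb_Cons)
  qed
qed simp

lemma ex_repeated_element:
  assumes "card (set bs) < n" "n\<^sup>2 \<le> length bs"
  shows "\<exists>u \<in> set bs. n \<le> count_list bs u"
proof (rule ccontr)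
  assume "\<not> ?thesis"
  then have "sum (count_list bs) (set bs) \<le> card (set bs) * n"
    using sum_bounded_above[of "set bs" "count_list bs" n] by fastforce
  also have "\<dots> < n\<^sup>2" using assms(1) by (simp add: power2_eq_square)
  finally show False using assms(2) by (simp add: sum_count_set)
qed

text \<open>Induction on the number \<open>j\<close> of rounds left. A round costs a factor
  \<open>3\<close> for glueing and \<open>n * n ^ 3\<close> for finding a run among at most
  \<open>n ^ 3\<close> glued blocks, while \<open>q\<close> triples. The final
  \<open>n\<^sup>2\<close> blocks, with fewer than \<open>n\<close> values, force one block to occur
  \<open>n\<close> times.\<close>

lemma power_or_divisible_if_few_blocks:
  assumes "n \<ge> 2" "d \<ge> 1"
    and "sublist (concat bs) W" "\<And>b. b \<in> set bs \<Longrightarrow> length b = q"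
    and "card (set bs) < n" "(3 * n ^ 4) ^ j * n\<^sup>2 \<le> length bs" "n * d \<le> 3 ^ j * q"
  shows "(\<exists>x. x \<noteq> [] \<and> sublist (word_power x d) W) \<or> n_divisible n W"
  using assms(3-)
proof (induction j arbitrary: bs q)
  case 0
  then obtain u where u: "u \<in> set bs" "n \<le> count_list bs u"
    using ex_repeated_element[of bs n] by auto
  have "sublist u W"
    using u(1) 0(1) by (metis concat.simps(2) concat_append in_set_conv_decomp sublist_appendI
        sublist_order.order_trans)
  have "disjoint_factors (replicate n u) W"
    using disjoint_factors_sublist[OF subseq_disjoint_factors[OF replicate_subseq[OF u(2)]] 0(1)] .
  moreover have "n * d \<le> length u" using 0 u(1) by simp
  ultimately show ?case
    using n_divisible_if_repeated_block[of n d u W] assms(1,2) \<open>sublist u W\<close>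
    by (meson order.trans one_le_numeral sublist_order.order_trans)
next
  case (Suc j)
  define cs where "cs = glue_triples bs"
  define s where "s = (3 * n ^ 4) ^ j * n\<^sup>2"
  show ?case
  proof (cases "n_divisible n W")
    case False
    have sub: "sublist (concat cs) W"
      unfolding cs_def using prefix_concat_glue_triples Suc.prems(1)
      by (meson prefix_imp_sublist sublist_order.order_trans)
    have q: "length c = 3 * q" if "c \<in> set cs" for c
      using that set_glue_triples[of bs] Suc.prems(2) unfolding cs_def by fastforce
    have "card (set cs) \<le> card (set bs) ^ 3"
      unfolding cs_def by (rule card_glue_triples)
    also have "\<dots> \<le> n ^ 3" using Suc.prems(3) by (simp add: power_mono)
    finally have card: "card (set cs) \<le> n ^ 3" .
    have "3 * (n ^ 4 * s) \<le> length bs"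
      using Suc.prems(4) by (simp add: s_def mult_ac)
    then have "n ^ 4 * s \<le> length cs"
      unfolding cs_def length_glue_triples by linarith
    then have "n * n ^ 3 * s \<le> length cs"
      by (simp flip: power_Suc)
    then obtain es where es: "sublist es cs" "length es = s" "card (set es) < n"
      using run_with_few_blocks[OF _ _ False sub q card, of s] \<open>n \<ge> 2\<close> by auto
    show ?thesis
    proof (rule Suc.IH)
      show "sublist (concat es) W"
        using sublist_concat[OF es(1)] sub by (rule sublist_order.order_trans)
      show "length b = 3 * q" if "b \<in> set es" for b
        using that q set_mono_sublist[OF es(1)] by blast
      show "n * d \<le> 3 ^ j * (3 * q)" using Suc.prems(5) by (simp add: mult_ac)
    qed (use es in \<open>auto simp: s_def\<close>)
  qed simp
qed

text \<open>The first run is taken among single letters, with \<open>l\<close> possible values and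
  no glueing; this accounts for the factor \<open>n * l\<close>.\<close>

lemma power_or_divisible_if_long:
  fixes W :: "'a::linorder list"
  assumes "n \<ge> 2" "d \<ge> 1" "l \<ge> 1" "finite A" "card A = l" "set W \<subseteq> A"
    and "n * d \<le> 3 ^ j" "n * l * ((3 * n ^ 4) ^ j * n\<^sup>2) \<le> length W"
  shows "(\<exists>x. x \<noteq> [] \<and> sublist (word_power x d) W) \<or> n_divisible n W"
proof (cases "n_divisible n W")
  case False
  define bs where "bs = map (\<lambda>a. [a]) W"
  have concat_bs: "concat bs = W" by (simp add: bs_def)
  have "card (set bs) \<le> card (set W)" by (simp add: bs_def card_image_le)
  also have "\<dots> \<le> l" using assms by (metis card_mono)
  finally have "card (set bs) \<le> l" .
  moreover have "length b = 1" if "b \<in> set bs" for b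
    using that by (auto simp: bs_def)
  ultimately obtain cs where
    cs: "sublist cs bs" "length cs = (3 * n ^ 4) ^ j * n\<^sup>2" "card (set cs) < n"
    using run_with_few_blocks[of n l W bs 1 "(3 * n ^ 4) ^ j * n\<^sup>2"] False assms
    unfolding concat_bs by (auto simp: bs_def)
  show ?thesis
  proof (rule power_or_divisible_if_few_blocks)
    show "sublist (concat cs) W" using sublist_concat[OF cs(1)] concat_bs by simp
    show "length b = 1" if "b \<in> set cs" for b
      using that set_mono_sublist[OF cs(1)] by (auto simp: bs_def)
  qed (use assms cs in auto)
qed simp

section \<open>Comparison with \<open>Psi\<close>\<close>

lemma Psi_lower_bound:
  assumes "n \<ge> 2" "d \<ge> n" and j: "j = nat \<lceil>log 3 (real (n * d))\<rceil>"
  shows "n * d \<le> 3 ^ j" "real (n * l * ((3 * n ^ 4) ^ j * n\<^sup>2)) \<le> Psi n d l"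
proof -
  define N where "N = n * d"
  \<comment> \<open>This is where \<open>d \<ge> n\<close> enters: a power of \<open>n\<close> is
    bounded by half as large a power of \<open>N\<close>.\<close>
  have "n\<^sup>2 \<le> N" using assms by (simp add: N_def power2_eq_square)
  then have "N \<ge> 4" using \<open>n \<ge> 2\<close> power_mono[of 2 n 2] by simp
  define L where "L = log 3 (real N)"
  have "L \<ge> 1" using \<open>N \<ge> 4\<close> by (simp add: L_def)
  then have jL: "L \<le> real j" "real j \<le> L + 1"
    unfolding j N_def[symmetric] L_def[symmetric] by linarith+
  have N3: "3 powr L = real N" using \<open>N \<ge> 4\<close> by (simp add: L_def)
  have "real N \<le> 3 powr real j"
    unfolding N3[symmetric] using jL by simp
  then have "real N \<le> real (3 ^ j)" by (simp add: powr_realpow)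
  then show "n * d \<le> 3 ^ j" unfolding N_def of_nat_le_iff .
  have "3 powr real j \<le> 3 powr (L + 1)" using jL by simp
  then have up: "3 ^ j \<le> 3 * real N" by (simp add: powr_realpow powr_add N3)
  have "n * ((n ^ 4) ^ j * n\<^sup>2) = n ^ (4 * j + 3)"
    by (simp add: numeral_3_eq_3 flip: power_mult power_add power_Suc)
  \<comment> \<open>The exponent \<open>4 * j + 3\<close> is rounded up to an even number.\<close>
  also have "\<dots> \<le> n ^ (2 * (2 * j + 2))" using \<open>n \<ge> 2\<close> by (intro power_increasing) auto
  also have "\<dots> = (n\<^sup>2) ^ (2 * j + 2)" by (simp only: power_mult)
  also have "\<dots> \<le> N ^ (2 * j + 2)" using \<open>n\<^sup>2 \<le> N\<close> by (intro power_mono) auto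
  finally have nN: "real (n * ((n ^ 4) ^ j * n\<^sup>2)) \<le> real N ^ (2 * j + 2)"
    by (metis of_nat_le_iff of_nat_power)
  have "real (n * l * ((3 * n ^ 4) ^ j * n\<^sup>2)) = real l * (3 ^ j * real (n * ((n ^ 4) ^ j * n\<^sup>2)))"
    by (simp add: power_mult_distrib mult_ac)
  also have "\<dots> \<le> real l * ((3 * real N) * real N ^ (2 * j + 2))"
    using up nN by (intro mult_left_mono mult_mono) auto
  also have "\<dots> = 3 * real l * real N ^ (2 * j + 3)" by (simp add: eval_nat_numeral)
  also have "\<dots> = 3 * real l * real N powr (2 * real j + 3)"
    using \<open>N \<ge> 4\<close> powr_realpow[of "real N" "2 * j + 3"] by simp
  also have "\<dots> \<le> 2 ^ 27 * real l * real N powr (3 * L + 9 * log 3 L + 36)"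
  proof (intro mult_mono powr_mono)
    \<comment> \<open>The exponent needed is at most \<open>2 * L + 5\<close>, so the iterated
      logarithm only has to be nonnegative.\<close>
    have "log 3 L \<ge> 0" using \<open>L \<ge> 1\<close> by simp
    then show "2 * real j + 3 \<le> 3 * L + 9 * log 3 L + 36" using jL \<open>L \<ge> 1\<close> by linarith
  qed (use \<open>N \<ge> 4\<close> in auto)
  finally show "real (n * l * ((3 * n ^ 4) ^ j * n\<^sup>2)) \<le> Psi n d l"
    by (simp add: Psi_def L_def N_def)
qed

theorem theorem1p7p3:
  fixes l n d :: nat and A :: "'a::linorder set" and W :: "'a list"
  assumes "l \<ge> 1" and "n \<ge> 1" and "d \<ge> n"
    and "finite A" and "card A = l"
    and "set W \<subseteq> A"
    and "real (length W) \<ge> Psi n d l"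
  shows "(\<exists>x. x \<noteq> [] \<and> sublist (word_power x d) W) \<or> n_divisible n W"
proof (cases "n = 1")
  case True
  \<comment> \<open>A single factor is vacuously decreasing. Treating this case apart guarantees
    \<open>n * d \<ge> 4\<close> and a nonnegative iterated logarithm in the other.\<close>
  have "W = [] @ concat [W]" "successively (\<succ>) [W]" by auto
  then show ?thesis unfolding n_divisible_def True by (metis length_Cons list.size(3) One_nat_def)
next
  case False
  then have "n \<ge> 2" using \<open>n \<ge> 1\<close> by simp
  define j where "j = nat \<lceil>log 3 (real (n * d))\<rceil>"
  have "real (n * l * ((3 * n ^ 4) ^ j * n\<^sup>2)) \<le> real (length W)"
    using Psi_lower_bound(2)[OF \<open>n \<ge> 2\<close> \<open>d \<ge> n\<close> j_def, of l] assms(7) by (rule order_trans)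
  then have "n * l * ((3 * n ^ 4) ^ j * n\<^sup>2) \<le> length W" unfolding of_nat_le_iff .
  then show ?thesis
    using power_or_divisible_if_long[OF \<open>n \<ge> 2\<close> _ assms(1,4,5,6) Psi_lower_bound(1)[OF \<open>n \<ge> 2\<close> \<open>d \<ge> n\<close> j_def]]
      assms(2,3) by simp
qed

end
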